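(* (Cassini's identity) For $n\in\mathbb{N}$: 1. $m\mathbb{O}_{k,n+1}m\mathbb{O}_{k,n-1}-m\mathbb{O}_{k,n}^2=2^{n-1}\left[\alpha\beta(\lambda_1^{2}-2)+\beta\alpha(\lambda_2^{2}-2)\right]$; 2. $m\mathbb{O}_{k,n-1}m\mathbb{O}_{k,n+1}-m\mathbb{O}_{k,n}^2=2^{n-1}\left[\alpha\beta(\lambda_2^{2}-2)+\beta\alpha(\lambda_1^{2}-2)\right]$. Here $\alpha=\sum_{r=0}^{7}\lambda_1^{r}e_r$ and $\beta=\sum_{r=0}^{7}\lambda_2^{r}e_r$.
   Context: $\mathbb{N}$ is the set of positive integers. $\mathbb{O}$ denotes the octonions, the $8$-dimensional real (non-commutative, non-associative) algebra with basis $e_0=1,e_1,\dots,e_7$ and bilinear multiplication determined by: $e_0$ is the identity, $e_a^2=-1$ for $a\ge1$, $e_ae_b=-e_be_a$ for distinct $a,b\ge1$, and $e_ae_b=e_c$, $e_be_c=e_a$, $e_ce_a=e_b$ for $(a,b,c)\in\{(1,2,3),(1,4,5),(1,7,6),(2,4,6),(2,5,7),(3,4,7),(3,6,5)\}$. For a parameter $k$, the $k$-Mersenne-Lucas numbers are defined by $m_{k,0}=2$, $m_{k,1}=3k$, $m_{k,n+1}=3km_{k,n}-2m_{k,n-1}$ for $n\ge1$. The $n$-th $k$-Mersenne-Lucas octonion is $m\mathbb{O}_{k,n}=\sum_{r=0}^{7}m_{k,n+r}e_r$ for $n\ge 0$. The numbers $\lambda_1=\frac{3k+\sqrt{9k^2-8}}{2}$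 and $\lambda_2=\frac{3k-\sqrt{9k^2-8}}{2}$ are the roots of $\lambda^2-3k\lambda+2=0$. *)

theory Defs
  imports Complex_Main
begin

text \<open>An octonion is given by its coordinates 0..7 with respect to the basis
  \<open>e\<^sub>0, \<dots>, e\<^sub>7\<close>; all further coordinates are zero.\<close>

typedef octonion = "{f :: nat \<Rightarrow> real. \<forall>i\<ge>8. f i = 0}"
  morphisms oct_coord Abs_octonion
  by (rule exI[of _ "\<lambda>_. 0"]) simp

setup_lifting type_definition_octonion

lemma octonion_eqI: "(\<And>i. i < 8 \<Longrightarrow> oct_coord x i = oct_coord y i) \<Longrightarrow> x = y"
proof transfer
  fix f g :: "nat \<Rightarrow> real"
  assume f: "\<forall>i\<ge>8. f i = 0" and g: "\<forall>i\<ge>8. g i = 0"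
    and eq: "\<And>i. i < 8 \<Longrightarrow> f i = g i"
  show "f = g"
  proof
    fix i show "f i = g i" using f g eq by (cases "i < 8") auto
  qed
qed

lift_definition oct_e :: "nat \<Rightarrow> octonion"
  is "\<lambda>r i. if i = r \<and> r < 8 then 1 else 0" by auto

definition oct_triples :: "(nat \<times> nat \<times> nat) set" where
  "oct_triples = {(1,2,3), (1,4,5), (1,7,6), (2,4,6), (2,5,7), (3,4,7), (3,6,5)}"

text \<open>\<open>oct_pos a b c\<close> says that \<open>e\<^sub>a e\<^sub>b = e\<^sub>c\<close> is one of the products prescribed by a
  triple, up to cyclic rotation.\<close>

definition oct_pos :: "nat \<Rightarrow> nat \<Rightarrow> nat \<Rightarrow> bool" where
  "oct_pos a b c \<longleftrightarrow>
     (a, b, c) \<in> oct_triples \<or> (b, c, a) \<in> oct_triples \<or> (c, a, b) \<in> oct_triples"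

text \<open>The coefficient of \<open>e\<^sub>c\<close> in the product \<open>e\<^sub>a e\<^sub>b\<close>.\<close>

definition oct_struct :: "nat \<Rightarrow> nat \<Rightarrow> nat \<Rightarrow> real" where
  "oct_struct a b c =
     (if a = 0 then (if c = b then 1 else 0)
      else if b = 0 then (if c = a then 1 else 0)
      else if a = b then (if c = 0 then -1 else 0)
      else if oct_pos a b c then 1
      else if oct_pos b a c then -1
      else 0)"

lemma oct_pos_less: "oct_pos a b c \<Longrightarrow> c < 8"
  by (auto simp: oct_pos_def oct_triples_def)

lemma oct_struct_beyond: "a < 8 \<Longrightarrow> b < 8 \<Longrightarrow> c \<ge> 8 \<Longrightarrow> oct_struct a b c = 0"
  using oct_pos_less[of a b c] oct_pos_less[of b a c] by (auto simp: oct_struct_def)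

instantiation octonion :: real_vector
begin

lift_definition zero_octonion :: octonion is "\<lambda>_. 0" by simp
lift_definition plus_octonion :: "octonion \<Rightarrow> octonion \<Rightarrow> octonion"
  is "\<lambda>x y i. x i + y i" by simp
lift_definition minus_octonion :: "octonion \<Rightarrow> octonion \<Rightarrow> octonion"
  is "\<lambda>x y i. x i - y i" by simp
lift_definition uminus_octonion :: "octonion \<Rightarrow> octonion"
  is "\<lambda>x i. - x i" by simp
lift_definition scaleR_octonion :: "real \<Rightarrow> octonion \<Rightarrow> octonion"
  is "\<lambda>r x i. r * x i" by simp

instance
  by standard (transfer; auto simp: algebra_simps fun_eq_iff)+

end

text \<open>Only the syntactic classes are available for the product, since it is not
  associative; \<open>x ^ 2\<close> unfolds to \<open>x * (x * 1)\<close>.\<close>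

instantiation octonion :: "{one, times}"
begin

definition one_octonion :: octonion where "1 = oct_e 0"

lift_definition times_octonion :: "octonion \<Rightarrow> octonion \<Rightarrow> octonion"
  is "\<lambda>x y c. \<Sum>a<8. \<Sum>b<8. x a * y b * oct_struct a b c"
  by (rule sum.neutral, rule ballI, rule sum.neutral)
    (simp add: oct_struct_beyond)

instance ..

end

instance octonion :: power ..

lemma oct_coord_simps [simp]:
  "oct_coord 0 i = 0"
  "oct_coord (x + y) i = oct_coord x i + oct_coord y i"
  "oct_coord (x - y) i = oct_coord x i - oct_coord y i"
  "oct_coord (- x) i = - oct_coord x i"
  "oct_coord (r *\<^sub>R x) i = r * oct_coord x i"
  by (transfer; simp)+

lemma oct_coord_mult:
  "oct_coord (x * y) c = (\<Sum>a<8. \<Sum>b<8. oct_coord x a * oct_coord y b * oct_struct a b c)"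
  by transfer simp

lemma oct_coord_e: "oct_coord (oct_e r) i = (if i = r \<and> r < 8 then 1 else 0)"
  by transfer simp

lemma oct_mult_bilinear:
  fixes x y z :: octonion
  shows "(x + y) * z = x * z + y * z" "z * (x + y) = z * x + z * y"
    "(r *\<^sub>R x) * y = r *\<^sub>R (x * y)" "x * (r *\<^sub>R y) = r *\<^sub>R (x * y)"
  by (rule octonion_eqI,
      simp add: oct_coord_mult distrib_left distrib_right sum.distrib sum_distrib_left mult_ac)+

lemma oct_coord_e_mult_e:
  assumes "a < 8" "b < 8"
  shows "oct_coord (oct_e a * oct_e b) c = oct_struct a b c"
proof -
  have "oct_coord (oct_e a * oct_e b) c =
      (\<Sum>i<8. \<Sum>j<8. if i = a then (if j = b then oct_struct i j c else 0) else 0)"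
    unfolding oct_coord_mult by (intro sum.cong refl) (auto simp: oct_coord_e assms)
  also have "\<dots> = (\<Sum>i<8. if i = a then oct_struct i b c else 0)"
    using assms by (intro sum.cong refl) (auto simp: sum.delta)
  also have "\<dots> = oct_struct a b c"
    using assms by (auto simp: sum.delta)
  finally show ?thesis .
qed

lemma oct_mult_one: "1 * x = x" "x * 1 = (x :: octonion)"
proof -
  have "oct_coord (1 * x) i = oct_coord x i" if "i < 8" for i
  proof -
    have "oct_coord (1 * x) i = (\<Sum>a<8::nat. \<Sum>b<8::nat. if b = i then (if a = 0 then oct_coord x b else 0) else 0)"
      unfolding one_octonion_def oct_coord_mult
      by (intro sum.cong refl) (simp add: oct_coord_e oct_struct_def)
    also have "\<dots> = (\<Sum>a<8::nat. if a = 0 then oct_coord x i else 0)"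
      using that by (intro sum.cong refl) (simp add: sum.delta)
    also have "\<dots> = oct_coord x i"
      using that by (simp add: sum.delta)
    finally show ?thesis .
  qed
  thus "1 * x = x" by (rule octonion_eqI)
  have "oct_coord (x * 1) i = oct_coord x i" if "i < 8" for i
  proof -
    have "oct_coord (x * 1) i = (\<Sum>a<8::nat. \<Sum>b<8::nat. if b = 0 then (if a = i then oct_coord x a else 0) else 0)"
      unfolding one_octonion_def oct_coord_mult
      by (intro sum.cong refl) (simp add: oct_coord_e oct_struct_def)
    also have "\<dots> = (\<Sum>a<8::nat. if a = i then oct_coord x a else 0)"
      using that by (intro sum.cong refl) (simp add: sum.delta)
    also have "\<dots> = oct_coord x i"
      using that by (simp add: sum.delta)
    finally show ?thesis .
  qed
  thus "x * 1 = x" by (rule octonion_eqI)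
qed

lemma oct_power2: "(x :: octonion)\<^sup>2 = x * x"
  by (simp add: numeral_2_eq_2 oct_mult_one)

lemma oct_e_square: "1 \<le> a \<Longrightarrow> a < 8 \<Longrightarrow> oct_e a * oct_e a = - 1"
  by (rule octonion_eqI)
    (auto simp: oct_coord_e_mult_e one_octonion_def oct_coord_e oct_struct_def)

lemma oct_pos_iff:
  "oct_pos a b c \<longleftrightarrow> (a, b, c) \<in>
     {(1,2,3), (1,4,5), (1,7,6), (2,4,6), (2,5,7), (3,4,7), (3,6,5),
      (2,3,1), (4,5,1), (7,6,1), (4,6,2), (5,7,2), (4,7,3), (6,5,3),
      (3,1,2), (5,1,4), (6,1,7), (6,2,4), (7,2,5), (7,3,4), (5,3,6)}"
  unfolding oct_pos_def oct_triples_def 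
  by (simp only: insert_iff empty_iff prod.inject conj_ac disj_ac simp_thms)

lemma oct_pos_facts:
  assumes "oct_pos a b c"
  shows "a \<noteq> 0" "b \<noteq> 0" "a \<noteq> b" "a < 8" "b < 8" "c < 8"
    "oct_pos a b d \<longleftrightarrow> d = c" "\<not> oct_pos b a d"
  using assms[unfolded oct_pos_iff] by (elim insertE emptyE; simp add: oct_pos_iff)+

lemma oct_e_anticommute:
  "1 \<le> a \<Longrightarrow> a < 8 \<Longrightarrow> 1 \<le> b \<Longrightarrow> b < 8 \<Longrightarrow> a \<noteq> b \<Longrightarrow> oct_e a * oct_e b = - (oct_e b * oct_e a)"
  using oct_pos_facts(8)[of a b] by (intro octonion_eqI)
    (auto simp: oct_coord_e_mult_e oct_struct_def)

lemma oct_e_pos: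
  assumes "oct_pos a b c"
  shows "oct_e a * oct_e b = oct_e c"
  using oct_pos_facts[OF assms] by (intro octonion_eqI)
    (simp add: oct_coord_e_mult_e oct_struct_def oct_coord_e)

lemma oct_e_triple:
  assumes "(a, b, c) \<in> oct_triples"
  shows "oct_e a * oct_e b = oct_e c" "oct_e b * oct_e c = oct_e a" "oct_e c * oct_e a = oct_e b"
  by (rule oct_e_pos, simp add: oct_pos_def assms)+

fun mersenne_lucas :: "real \<Rightarrow> nat \<Rightarrow> real" where
  "mersenne_lucas k 0 = 2"
| "mersenne_lucas k (Suc 0) = 3 * k"
| "mersenne_lucas k (Suc (Suc n)) = 3 * k * mersenne_lucas k (Suc n) - 2 * mersenne_lucas k n"

definition mersenne_lucas_oct :: "real \<Rightarrow> nat \<Rightarrow> octonion" where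
  "mersenne_lucas_oct k n = (\<Sum>r=0..7. mersenne_lucas k (n + r) *\<^sub>R oct_e r)"

text \<open>These are the roots of \<open>\<lambda>\<^sup>2 - 3k\<lambda> + 2 = 0\<close> only if \<open>9k\<^sup>2 \<ge> 8\<close>: the library's
  \<open>sqrt\<close> is odd and hence not a square root on negative arguments.\<close>

definition ml_root1 :: "real \<Rightarrow> real" where
  "ml_root1 k = (3 * k + sqrt (9 * k\<^sup>2 - 8)) / 2"

definition ml_root2 :: "real \<Rightarrow> real" where
  "ml_root2 k = (3 * k - sqrt (9 * k\<^sup>2 - 8)) / 2"

lemma ml_root_quadratic:
  assumes "9 * k\<^sup>2 \<ge> 8"
  shows "(ml_root1 k)\<^sup>2 - 3 * k * ml_root1 k + 2 = 0"
    "(ml_root2 k)\<^sup>2 - 3 * k * ml_root2 k + 2 = 0"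
proof -
  have s: "sqrt (9 * k\<^sup>2 - 8) * sqrt (9 * k\<^sup>2 - 8) = 9 * k\<^sup>2 - 8"
    using assms by simp
  show "(ml_root1 k)\<^sup>2 - 3 * k * ml_root1 k + 2 = 0"
    "(ml_root2 k)\<^sup>2 - 3 * k * ml_root2 k + 2 = 0"
    using s by (simp_all add: ml_root1_def ml_root2_def power2_eq_square field_simps)
qed

definition ml_alpha :: "real \<Rightarrow> octonion" where
  "ml_alpha k = (\<Sum>r=0..7. ml_root1 k ^ r *\<^sub>R oct_e r)"

definition ml_beta :: "real \<Rightarrow> octonion" where
  "ml_beta k = (\<Sum>r=0..7. ml_root2 k ^ r *\<^sub>R oct_e r)"

end

theory Submission
  imports Defs
begin

text \<open>
  The identity is a consequence of the Binet formula
  \<open>mO\<^sub>n = \<lambda>\<^sub>1\<^sup>n \<alpha> + \<lambda>\<^sub>2\<^sup>n \<beta>\<close> (\<open>mersenne_lucas_oct_Binet\<close>), which holds coordinatewise because the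
  scalar sequence and \<open>\<lambda>\<^sub>1\<^sup>n + \<lambda>\<^sub>2\<^sup>n\<close> obey the same recurrence with the same initial values;
  \<open>9 k\<^sup>2 \<ge> 8\<close> makes \<open>\<lambda>\<^sub>1\<close> and \<open>\<lambda>\<^sub>2\<close> real roots of its characteristic polynomial.
  In a product \<open>mO\<^sub>i mO\<^sub>j\<close> the terms \<open>\<alpha>\<alpha>\<close> and \<open>\<beta>\<beta>\<close> carry the coefficients \<open>\<lambda>\<^sub>1\<^sup>i\<^sup>+\<^sup>j\<close> and
  \<open>\<lambda>\<^sub>2\<^sup>i\<^sup>+\<^sup>j\<close>, which depend only on \<open>i + j\<close>. They therefore cancel in a difference of two
  products of equal total index (\<open>geometric_mult_difference\<close>), and only the mixed terms
  \<open>\<alpha>\<beta>\<close> and \<open>\<beta>\<alpha>\<close> survive. These stay separate, as \<open>\<alpha>\<close> and \<open>\<beta>\<close> need not commute.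
  Finally \<open>\<lambda>\<^sub>1 \<lambda>\<^sub>2 = 2\<close> turns a coefficient such as
  \<open>\<lambda>\<^sub>1\<^sup>m\<^sup>+\<^sup>2 \<lambda>\<^sub>2\<^sup>m - (\<lambda>\<^sub>1 \<lambda>\<^sub>2)\<^sup>m\<^sup>+\<^sup>1\<close> into \<open>2\<^sup>m (\<lambda>\<^sub>1\<^sup>2 - 2)\<close>.
\<close>

lemma ml_root_sum: "ml_root1 k + ml_root2 k = 3 * k"
  by (simp add: ml_root1_def ml_root2_def field_simps)

lemma ml_root_prod:
  assumes "9 * k\<^sup>2 \<ge> 8"
  shows "ml_root1 k * ml_root2 k = 2"
proof -
  have "sqrt (9 * k\<^sup>2 - 8) * sqrt (9 * k\<^sup>2 - 8) = 9 * k\<^sup>2 - 8"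
    using assms by simp
  thus ?thesis
    by (simp add: ml_root1_def ml_root2_def power2_eq_square field_simps)
qed

lemma mersenne_lucas_Binet:
  assumes "9 * k\<^sup>2 \<ge> 8"
  shows "mersenne_lucas k n = ml_root1 k ^ n + ml_root2 k ^ n"
  using assms
proof (induction k n rule: mersenne_lucas.induct)
  case (3 k n)
  let ?a = "ml_root1 k" and ?b = "ml_root2 k"
  have sq: "?a\<^sup>2 = 3 * k * ?a - 2" "?b\<^sup>2 = 3 * k * ?b - 2"
    using ml_root_quadratic[OF "3.prems"] by simp_all
  have "?a ^ Suc (Suc n) + ?b ^ Suc (Suc n) = ?a ^ n * ?a\<^sup>2 + ?b ^ n * ?b\<^sup>2"
    by (simp add: power2_eq_square)
  also have "\<dots> = 3 * k * (?a ^ Suc n + ?b ^ Suc n) - 2 * (?a ^ n + ?b ^ n)"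
    unfolding sq by (simp add: algebra_simps)
  finally show ?case
    using 3 by simp
qed (simp_all add: ml_root_sum)

lemma mersenne_lucas_oct_Binet:
  assumes "9 * k\<^sup>2 \<ge> 8"
  shows "mersenne_lucas_oct k n = ml_root1 k ^ n *\<^sub>R ml_alpha k + ml_root2 k ^ n *\<^sub>R ml_beta k"
  unfolding mersenne_lucas_oct_def ml_alpha_def ml_beta_def mersenne_lucas_Binet[OF assms]
  by (simp only: scaleR_sum_right scaleR_scaleR power_add scaleR_left_distrib sum.distrib)

text \<open>By bilinearity, \<open>p * p\<close> gets the coefficients \<open>a\<^sup>i\<^sup>+\<^sup>j\<close> and \<open>a\<^sup>s\<^sup>+\<^sup>t\<close> in the two products, and
  \<open>q * q\<close> the same powers of \<open>b\<close>; equality of the index sums makes these pure terms drop out.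
  For \<open>s = t\<close> this is a Catalan-type identity, and \<open>(i, j) = (s + 1, s - 1)\<close> or its reverse
  gives the two noncommutative Cassini identities.\<close>

lemma geometric_mult_difference:
  fixes p q :: octonion and a b :: real
  assumes "i + j = s + t"
  shows "(a ^ i *\<^sub>R p + b ^ i *\<^sub>R q) * (a ^ j *\<^sub>R p + b ^ j *\<^sub>R q)
           - (a ^ s *\<^sub>R p + b ^ s *\<^sub>R q) * (a ^ t *\<^sub>R p + b ^ t *\<^sub>R q)
         = (a ^ i * b ^ j - a ^ s * b ^ t) *\<^sub>R (p * q)
           + (b ^ i * a ^ j - b ^ s * a ^ t) *\<^sub>R (q * p)"
proof -
  have expand: "(a ^ m *\<^sub>R p + b ^ m *\<^sub>R q) * (a ^ l *\<^sub>R p + b ^ l *\<^sub>R q)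
      = a ^ (m + l) *\<^sub>R (p * p) + (a ^ m * b ^ l) *\<^sub>R (p * q)
        + (b ^ m * a ^ l) *\<^sub>R (q * p) + b ^ (m + l) *\<^sub>R (q * q)" for m l
    by (simp add: oct_mult_bilinear scaleR_right_distrib power_add mult.commute)
  show ?thesis
    unfolding expand assms by (simp add: scaleR_left_diff_distrib)
qed

theorem theorem3p4:
  fixes k :: real and n :: nat
  assumes "9 * k\<^sup>2 \<ge> 8" and "n \<ge> 1"
  shows "mersenne_lucas_oct k (n + 1) * mersenne_lucas_oct k (n - 1) - (mersenne_lucas_oct k n)\<^sup>2
           = 2 ^ (n - 1) *\<^sub>R
               (((ml_root1 k)\<^sup>2 - 2) *\<^sub>R (ml_alpha k * ml_beta k)
                + ((ml_root2 k)\<^sup>2 - 2) *\<^sub>R (ml_beta k * ml_alpha k))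
       \<and> mersenne_lucas_oct k (n - 1) * mersenne_lucas_oct k (n + 1) - (mersenne_lucas_oct k n)\<^sup>2
           = 2 ^ (n - 1) *\<^sub>R
               (((ml_root2 k)\<^sup>2 - 2) *\<^sub>R (ml_alpha k * ml_beta k)
                + ((ml_root1 k)\<^sup>2 - 2) *\<^sub>R (ml_beta k * ml_alpha k))"
proof -
  let ?a = "ml_root1 k" and ?b = "ml_root2 k"
  from \<open>n \<ge> 1\<close> obtain m where n: "n = Suc m"
    by (cases n) auto
  have ab: "?a * ?b = 2"
    by (rule ml_root_prod[OF assms(1)])
  have diag: "?a ^ Suc m * ?b ^ Suc m = 2 ^ m * 2" "?b ^ Suc m * ?a ^ Suc m = 2 ^ m * 2"
    using power_mult_distrib[of ?a ?b "Suc m"] by (simp_all add: ab mult.commute)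
  have mixed1: "?a ^ (m + 2) * ?b ^ m = 2 ^ m * ?a\<^sup>2" "?b ^ m * ?a ^ (m + 2) = 2 ^ m * ?a\<^sup>2"
    using power_mult_distrib[of ?a ?b m] by (simp_all add: ab power_add power2_eq_square)
  have mixed2: "?b ^ (m + 2) * ?a ^ m = 2 ^ m * ?b\<^sup>2" "?a ^ m * ?b ^ (m + 2) = 2 ^ m * ?b\<^sup>2"
    using power_mult_distrib[of ?a ?b m] by (simp_all add: ab power_add power2_eq_square)
  note coeffs = diag mixed1 mixed2 right_diff_distrib[symmetric]
    scaleR_scaleR[symmetric] scaleR_right_distrib[symmetric]
  have idx: "n + 1 = m + 2" "n - 1 = m"
    using n by simp_all
  have "(m + 2) + m = Suc m + Suc m" "m + (m + 2) = Suc m + Suc m"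
    by simp_all
  note differences = this[THEN geometric_mult_difference[of _ _ _ _ ?a "ml_alpha k" ?b "ml_beta k"]]
  show ?thesis
    unfolding idx oct_power2 mersenne_lucas_oct_Binet[OF assms(1)]
    unfolding n differences by (simp only: coeffs simp_thms)
qed

end
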